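(* For all positive integers $m\le n$ and $k\le n$, $$M_R(m,n,k)\le \left(\sqrt{k^2-1}\right)^{\frac m2-\frac{n}{2k}}\,k^{\frac{n}{2k}}.$$ If $m=n$, let $$c_k=\left(\sqrt{k^2-1}\right)^{\frac12\left(1-\frac1k\right)}k^{\frac1{2k}}.$$ Then $M_R(n,k)\le c_k^{\,n}$. Moreover, $c_k<\sqrt k$.
   Context: $R(m,n,k)$ denotes the set of $m\times n$ matrices with entries in $\{0,1\}$ each of whose rows sums to $k$; $R(n,k)$ denotes the set of $n\times n$ matrices with entries in $\{0,1\}$ each of whose rows sums to $k$. For a real $m\times n$ matrix $A$ with $m\le n$, $\mathrm{Vol}(A)=\sqrt{\det(AA^T)}$. $M_R(m,n,k)=\max_{A\in R(m,n,k)}\mathrm{Vol}(A)$ and $M_R(n,k)=\max_{A\in R(n,k)}\det(A)$.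
   Formalization: For k=1 the first bound is claimed only when m=n (with 0^0=1), since for m<n its right side is 0 to a negative power and undefined; and c_k<√k is claimed only for k≥2, since c_1=1=√1. *)

theory Defs
  imports Complex_Main "Jordan_Normal_Form.Determinant"
begin

definition R :: "nat \<Rightarrow> nat \<Rightarrow> nat \<Rightarrow> real mat set" where
  "R m n k = {A \<in> carrier_mat m n.
     (\<forall>i<m. \<forall>j<n. A $$ (i, j) \<in> {0, 1}) \<and>
     (\<forall>i<m. (\<Sum>j<n. A $$ (i, j)) = real k)}"

definition Vol :: "real mat \<Rightarrow> real" where
  "Vol A = sqrt (det (A * A\<^sup>T))"

lemma finite_R: "finite (R m n k)"
proof -
  let ?P = "{..<m} \<times> {..<n}"
  let ?F = "?P \<rightarrow>\<^sub>E {0, 1 :: real}"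
  have "R m n k \<subseteq> mat m n ` ?F"
  proof
    fix A assume A: "A \<in> R m n k"
    have "A = mat m n (restrict (($$) A) ?P)"
      using A by (intro eq_matI) (auto simp: R_def)
    moreover have "restrict (($$) A) ?P \<in> ?F"
      using A by (auto simp: R_def)
    ultimately show "A \<in> mat m n ` ?F" by blast
  qed
  moreover have "finite ?F" by (intro finite_PiE) auto
  ultimately show ?thesis by (blast intro: finite_subset)
qed

lemma R_nonempty:
  assumes "k \<le> n"
  shows "R m n k \<noteq> {}"
proof -
  have "(\<Sum>j<n. if j < k then 1 else 0 :: real) = real k"
  proof -
    have "{..<n} \<inter> {j. j < k} = {..<k}" using assms by auto
    then show ?thesis by (simp add: sum.If_cases)
  qed
  then have "mat m n (\<lambda>(i, j). if j < k then 1 else 0) \<in> R m n k"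
    by (auto simp: R_def)
  then show ?thesis by blast
qed

text \<open>For \<open>k \<le> n\<close> both maxima range over finite nonempty sets, by the two lemmas above.
  The square case maximises the signed determinant, not \<open>Vol\<close>.\<close>

definition M_R :: "nat \<Rightarrow> nat \<Rightarrow> nat \<Rightarrow> real" where
  "M_R m n k = Max (Vol ` R m n k)"

definition M_R_square :: "nat \<Rightarrow> nat \<Rightarrow> real" where
  "M_R_square n k = Max (det ` R n n k)"

text \<open>Real powers of a nonnegative base. The library sets \<open>0 powr 0 = 0\<close>; the usual
  convention that the zeroth power is 1 is needed here, as \<open>sqrt (k\<^sup>2 - 1) = 0\<close> for \<open>k = 1\<close>.
  A negative power of 0 has no meaning, and gets the junk value 0.\<close>

definition rpow :: "real \<Rightarrow> real \<Rightarrow> real" where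
  "rpow x a = (if a = 0 then 1 else x powr a)"

definition c :: "nat \<Rightarrow> real" where
  "c k = rpow (sqrt ((real k)\<^sup>2 - 1)) (1 / 2 * (1 - 1 / real k))
         * rpow (real k) (1 / (2 * real k))"

end

theory Submission
  imports Defs "HOL-Combinatorics.Permutations"
begin

text \<open>
  The square of \<open>Vol A\<close> is the Gram determinant of the rows of \<open>A\<close>, the squared volume of the
  parallelepiped that they span. Each row has squared length \<open>k\<close>, so Hadamard's inequality bounds
  the volume by \<open>sqrt k ^ m\<close>. The improvement comes from rows that overlap: two of them have inner
  product at least 1, so the parallelogram that they span has area at most \<open>sqrt (k\<^sup>2 - 1)\<close>
  instead of \<open>k\<close>.

  Overlapping rows are paired off greedily. This leaves \<open>p\<close> pairs and \<open>u\<close> rows with pairwise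
  disjoint supports, where \<open>m = 2 * p + u\<close>. The \<open>u\<close> disjoint supports have \<open>k\<close> elements each among
  \<open>n\<close> columns, so \<open>u * k \<le> n\<close>. The volume of a parallelepiped is at most the product
  of the volumes spanned by the blocks of a partition of its edges (Fischer's inequality). Blocks of
  size 2 and 1 give \<open>Vol A \<le> sqrt (k\<^sup>2 - 1) ^ p * sqrt k ^ u\<close>; this is
  \<open>gram_det_zero_one_vecs_le\<close>. For \<open>k \<ge> 2\<close>, since \<open>0 < sqrt (k\<^sup>2 - 1) < k\<close>, the
  right-hand side grows with \<open>u\<close> when \<open>2 * p + u = m\<close> is kept fixed, and the extreme value \<open>u = n / k\<close> yields the claimed bound.

  The geometric input is \<open>gram_det_Cons\<close>: adjoining a vector multiplies the Gram determinant by
  the squared distance from that vector to the span of the others. Bounding this distance by the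
  distance to the origin, or to the line through one other vector, gives the case of Fischer's
  inequality where a block of size 1 or 2 is split off.
\<close>

section \<open>Gram determinants\<close>

definition gram_det :: "nat \<Rightarrow> real vec list \<Rightarrow> real" where
  "gram_det n vs = det (mat_of_rows n vs * (mat_of_rows n vs)\<^sup>T)"

lemma gram_entry:
  assumes "set vs \<subseteq> carrier_vec n" "i < length vs" "j < length vs"
  shows "(mat_of_rows n vs * (mat_of_rows n vs)\<^sup>T) $$ (i, j) = vs ! i \<bullet> vs ! j"
proof -
  have "vs ! i \<in> carrier_vec n" "vs ! j \<in> carrier_vec n"
    using assms nth_mem by blast+
  then show ?thesis using assms by simp
qed

lemma gram_det_Nil: "gram_det n [] = 1"
  unfolding gram_det_def by (rule det_dim_zero) (auto intro: carrier_matI)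

text \<open>
  Permuting the vectors permutes the rows and the columns of the Gram matrix simultaneously, so the
  sign of the permutation enters twice. The pairing argument needs this in order to move two
  chosen vectors to the front.
\<close>

lemma gram_det_permute:
  assumes vs: "set vs \<subseteq> carrier_vec n" and eq: "mset us = mset vs"
  shows "gram_det n us = gram_det n vs"
proof -
  obtain p where p: "p permutes {..<length vs}" "permute_list p vs = us"
    using mset_eq_permutation[OF eq] by blast
  define l where "l = length vs"
  have len: "length us = l" using p(2) by (auto simp: l_def)
  have p': "p permutes {0..<l}" using p(1) by (simp add: l_def lessThan_atLeast0)
  have us: "us ! i = vs ! p i" if "i < l" for i
    using p that by (auto simp: l_def permute_list_nth)
  have pl: "p i < l" if "i < l" for i
    using permutes_in_image[OF p'] that by auto
  have setu: "set us \<subseteq> carrier_vec n" using vs mset_eq_setD[OF eq] by simp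
  define G where "G = mat_of_rows n vs * (mat_of_rows n vs)\<^sup>T"
  define H where "H = mat l l (\<lambda>(i, j). G $$ (p i, j))"
  define K where "K = mat l l (\<lambda>(i, j). H\<^sup>T $$ (p i, j))"
  have G: "G \<in> carrier_mat l l" by (intro carrier_matI) (simp_all add: G_def l_def)
  have H: "H \<in> carrier_mat l l" by (simp add: H_def)
  have "mat_of_rows n us * (mat_of_rows n us)\<^sup>T = K\<^sup>T"
  proof (rule eq_matI)
    fix i j assume "i < dim_row K\<^sup>T" "j < dim_col K\<^sup>T"
    then have ij: "i < l" "j < l" by (auto simp: K_def)
    have "(mat_of_rows n us * (mat_of_rows n us)\<^sup>T) $$ (i, j) = us ! i \<bullet> us ! j"
      using gram_entry[OF setu] ij len by simp
    also have "\<dots> = G $$ (p i, p j)"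
      unfolding G_def using gram_entry[OF vs, of "p i" "p j"] ij pl us by (simp add: l_def)
    also have "\<dots> = K\<^sup>T $$ (i, j)" using ij pl by (simp add: K_def H_def)
    finally show "(mat_of_rows n us * (mat_of_rows n us)\<^sup>T) $$ (i, j) = K\<^sup>T $$ (i, j)" .
  qed (auto simp: K_def len)
  then have "gram_det n us = det K\<^sup>T" by (simp add: gram_det_def)
  also have "\<dots> = det K" by (rule det_transpose[of _ l]) (simp add: K_def)
  also have "\<dots> = signof p * (signof p * det G)"
    unfolding K_def using det_permute_rows[OF _ p', of "H\<^sup>T"] det_transpose[OF H]
      det_permute_rows[OF G p'] H by (simp add: H_def)
  also have "\<dots> = det G" by (simp add: sign_def)
  finally show ?thesis by (simp add: gram_det_def G_def)
qed

text \<open>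
  The vector \<open>w\<close> is the component of \<open>v\<close> orthogonal to the span of \<open>vs\<close>. As \<open>(mat_of_rows n vs)\<^sup>T *\<^sub>v y\<close>
  ranges over that span, the last conclusion says that \<open>w \<bullet> w\<close> is at most the squared distance from
  \<open>v\<close> to any vector of the span. When \<open>vs\<close> is linearly dependent both determinants
  vanish, and \<open>w = 0\<close> serves.
\<close>

lemma gram_det_Cons:
  assumes v: "v \<in> carrier_vec n" and vs: "set vs \<subseteq> carrier_vec n"
  obtains w where "w \<in> carrier_vec n" "gram_det n (v # vs) = (w \<bullet> w) * gram_det n vs"
    "\<And>y. y \<in> carrier_vec (length vs) \<Longrightarrow>
       w \<bullet> w \<le> (v - (mat_of_rows n vs)\<^sup>T *\<^sub>v y) \<bullet> (v - (mat_of_rows n vs)\<^sup>T *\<^sub>v y)"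
proof -
  define l where "l = length vs"
  define B where "B = mat_of_rows n vs"
  define G where "G = B * B\<^sup>T"
  define b where "b = B *\<^sub>v v"
  define M where "M = mat_of_rows n (v # vs) * (mat_of_rows n (v # vs))\<^sup>T"
  have B: "B \<in> carrier_mat l n" and BT: "B\<^sup>T \<in> carrier_mat n l" by (auto simp: B_def l_def)
  have G: "G \<in> carrier_mat l l" and b: "b \<in> carrier_vec l"
    using B v by (auto simp: G_def b_def)
  have M: "M \<in> carrier_mat (1 + l) (1 + l)"
    by (intro carrier_matI) (simp_all add: M_def l_def)
  have set': "set (v # vs) \<subseteq> carrier_vec n" using v vs by simp
  have dets: "gram_det n (v # vs) = det M" "gram_det n vs = det G"
    by (auto simp: gram_det_def M_def G_def B_def)
  have nonneg: "x \<bullet> x \<ge> 0" for x :: "real vec"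
    by (auto simp: scalar_prod_def intro: sum_nonneg)
  have vsc: "vs ! i \<in> carrier_vec n" if "i < l" for i
    using that vs nth_mem unfolding l_def by blast
  have b_nth: "b $ i = vs ! i \<bullet> v" if "i < l" for i
    using that vsc[OF that] by (simp add: b_def B_def l_def)
  \<comment> \<open>Split off the row and the column of \<open>v\<close> from its Gram matrix with \<open>vs\<close>.\<close>
  have blocks: "M = four_block_mat (mat 1 1 (\<lambda>_. v \<bullet> v)) (mat 1 l (\<lambda>(i, j). b $ j))
      (mat l 1 (\<lambda>(i, j). b $ i)) G" (is "M = ?M")
  proof (rule eq_matI)
    fix i j assume "i < dim_row ?M" "j < dim_col ?M"
    then have ij: "i < Suc l" "j < Suc l" using G by auto
    have "M $$ (i, j) = (v # vs) ! i \<bullet> (v # vs) ! j"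
      unfolding M_def using gram_entry[OF set'] ij by (simp add: l_def)
    moreover have "v \<bullet> vs ! q = vs ! q \<bullet> v" if "q < l" for q
      using comm_scalar_prod[OF v vsc[OF that]] .
    ultimately show "M $$ (i, j) = ?M $$ (i, j)"
      using ij G gram_entry[OF vs] by (cases i; cases j) (auto simp: b_nth G_def B_def l_def)
  qed (use M G in auto)
  show thesis
  proof (cases "det G = 0")
    case True
    then obtain c where c: "c \<in> carrier_vec l" "c \<noteq> 0\<^sub>v l" "G *\<^sub>v c = 0\<^sub>v l"
      using det_0_iff_vec_prod_zero[OF G] by blast
    \<comment> \<open>A kernel vector of \<open>B * B\<^sup>T\<close> is one of \<open>B\<^sup>T\<close>; padding it by a zero gives a kernel vector of
      the larger Gram matrix.\<close>
    have BTc: "B\<^sup>T *\<^sub>v c \<in> carrier_vec n" using BT c by auto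
    have "(B\<^sup>T *\<^sub>v c) \<bullet> (B\<^sup>T *\<^sub>v c) = c \<bullet> (G *\<^sub>v c)"
      using transpose_vec_mult_scalar[OF B BTc c(1)] assoc_mult_mat_vec[OF B BT c(1)]
      by (simp add: G_def)
    then have "(B\<^sup>T *\<^sub>v c) \<bullet> (B\<^sup>T *\<^sub>v c) = 0" using c by simp
    then have z: "B\<^sup>T *\<^sub>v c = 0\<^sub>v n"
      using conjugate_square_eq_0_vec[OF BTc] by simp
    have bc: "b \<bullet> c = 0"
      using transpose_vec_mult_scalar[OF B v c(1)] z v comm_scalar_prod[OF b c(1)]
      by (simp add: b_def)
    define d where "d = vec 1 (\<lambda>_. 0 :: real) @\<^sub>v c"
    have d: "d \<in> carrier_vec (1 + l)" using c unfolding d_def by (intro append_carrier_vec) auto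
    have "M *\<^sub>v d = 0\<^sub>v (1 + l)"
    proof -
      have "mat 1 l (\<lambda>(i, j). b $ j) *\<^sub>v c = 0\<^sub>v 1"
      proof (rule eq_vecI)
        fix i assume "i < dim_vec (0\<^sub>v 1 :: real vec)"
        moreover have "b \<bullet> c = (\<Sum>j<l. b $ j * c $ j)"
          using c by (auto simp: scalar_prod_def lessThan_atLeast0)
        ultimately show "(mat 1 l (\<lambda>(i, j). b $ j) *\<^sub>v c) $ i = 0\<^sub>v 1 $ i"
          using bc c by (simp add: scalar_prod_def lessThan_atLeast0)
      qed simp
      moreover have "mat l 1 (\<lambda>(i, j). b $ i) *\<^sub>v vec 1 (\<lambda>_. 0) = 0\<^sub>v l"
        by (rule eq_vecI) (auto simp: scalar_prod_def)
      moreover have "mat 1 1 (\<lambda>_. v \<bullet> v) *\<^sub>v vec 1 (\<lambda>_. 0) = 0\<^sub>v 1"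
        by (rule eq_vecI) (auto simp: scalar_prod_def)
      ultimately show ?thesis unfolding blocks d_def
        by (subst four_block_mat_mult_vec[of _ 1 1 _ l _ l]) (use G c in auto)
    qed
    moreover have "d \<noteq> 0\<^sub>v (1 + l)"
    proof
      assume eq: "d = 0\<^sub>v (1 + l)"
      have "c $ i = 0" if "i < l" for i
      proof -
        have "d $ Suc i = c $ i" using that c by (simp add: d_def)
        then show ?thesis using eq that by simp
      qed
      then have "c = 0\<^sub>v l" using c(1) by (intro eq_vecI) auto
      then show False using c(2) by simp
    qed
    ultimately have "det M = 0" using det_0_iff_vec_prod_zero[OF M] d by blast
    then show thesis
      by (intro that[of "0\<^sub>v n"]) (auto simp: dets True nonneg)
  next
    case False
    \<comment> \<open>By the normal equations \<open>G *\<^sub>v c = b\<close>, the vector \<open>B\<^sup>T *\<^sub>v c\<close> is the orthogonal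
      projection of \<open>v\<close> onto the span.\<close>
    define c where "c = (1 / det G) \<cdot>\<^sub>v (adj_mat G *\<^sub>v b)"
    have adj: "adj_mat G \<in> carrier_mat l l" "G * adj_mat G = det G \<cdot>\<^sub>m 1\<^sub>m l"
      using adj_mat[OF G] by auto
    have c: "c \<in> carrier_vec l" using adj b by (auto simp: c_def)
    have Gc: "G *\<^sub>v c = b"
    proof -
      have "G *\<^sub>v c = (1 / det G) \<cdot>\<^sub>v ((G * adj_mat G) *\<^sub>v b)"
        unfolding c_def assoc_mult_mat_vec[OF G adj(1) b]
        by (rule mult_mat_vec[OF G]) (use adj b in simp)
      also have "\<dots> = b" unfolding adj(2) using b False
        by (intro eq_vecI) auto
      finally show ?thesis .
    qed
    have BTc: "B\<^sup>T *\<^sub>v c \<in> carrier_vec n" using BT c by auto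
    define w where "w = v - B\<^sup>T *\<^sub>v c"
    have w: "w \<in> carrier_vec n" using v BTc by (simp add: w_def)
    have Bw: "B *\<^sub>v w = 0\<^sub>v l"
    proof -
      have "B *\<^sub>v w = B *\<^sub>v v - G *\<^sub>v c"
        unfolding w_def G_def assoc_mult_mat_vec[OF B BT c]
        by (rule mult_minus_distrib_mat_vec[OF B v BTc])
      then show ?thesis using b by (simp add: Gc b_def[symmetric])
    qed
    have orth: "(B\<^sup>T *\<^sub>v y) \<bullet> w = 0" if "y \<in> carrier_vec l" for y
      using transpose_vec_mult_scalar[OF B w that] that by (simp add: Bw)
    have orth': "w \<bullet> (B\<^sup>T *\<^sub>v y) = 0" if "y \<in> carrier_vec l" for y
      using orth[OF that] comm_scalar_prod[OF w, of "B\<^sup>T *\<^sub>v y"] BT that by auto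
    have ww: "w \<bullet> w = v \<bullet> v - b \<bullet> c"
    proof -
      have "w \<bullet> w = v \<bullet> w"
        using minus_scalar_prod_distrib[OF v BTc w] orth[OF c] by (simp add: w_def[symmetric])
      also have "\<dots> = v \<bullet> v - v \<bullet> (B\<^sup>T *\<^sub>v c)"
        unfolding w_def by (rule scalar_prod_minus_distrib[OF v v BTc])
      also have "v \<bullet> (B\<^sup>T *\<^sub>v c) = b \<bullet> c"
        using transpose_vec_mult_scalar[OF B v c] comm_scalar_prod[OF v BTc] comm_scalar_prod[OF b c]
        by (simp add: b_def)
      finally show ?thesis .
    qed
    have minimal: "w \<bullet> w \<le> (v - B\<^sup>T *\<^sub>v y) \<bullet> (v - B\<^sup>T *\<^sub>v y)" if y: "y \<in> carrier_vec l" for y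
    proof -
      define z where "z = B\<^sup>T *\<^sub>v (c - y)"
      have cy: "c - y \<in> carrier_vec l" using c y by simp
      have z: "z \<in> carrier_vec n" using BT cy by (auto simp: z_def)
      have BTy: "B\<^sup>T *\<^sub>v y \<in> carrier_vec n" using BT y by auto
      have split: "v - B\<^sup>T *\<^sub>v y = w + z"
        unfolding z_def w_def mult_minus_distrib_mat_vec[OF BT c y]
        using v BTc BTy by (intro eq_vecI) auto
      have "(w + z) \<bullet> (w + z) = w \<bullet> w + z \<bullet> z"
        using orth[OF cy] orth'[OF cy] w z
        by (simp add: add_scalar_prod_distrib[of _ n] scalar_prod_add_distrib[of _ n] z_def[symmetric])
      then show ?thesis using nonneg[of z] by (simp add: split)
    qed
    \<comment> \<open>The column operation that subtracts from the first column the combination \<open>c\<close> of the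
      others clears \<open>b\<close> below the corner, and leaves \<open>v \<bullet> v - b \<bullet> c = w \<bullet> w\<close> there.\<close>
    define U where "U = four_block_mat (1\<^sub>m 1) (0\<^sub>m 1 l) (mat l 1 (\<lambda>(i, j). - c $ i)) (1\<^sub>m l)"
    have U: "U \<in> carrier_mat (1 + l) (1 + l)"
      unfolding U_def by (rule four_block_carrier_mat) auto
    have "det U = 1"
      unfolding U_def by (subst det_four_block_mat_upper_right_zero[of _ 1 _ l]) auto
    have "M * U = four_block_mat (mat 1 1 (\<lambda>_. w \<bullet> w)) (mat 1 l (\<lambda>(i, j). b $ j)) (0\<^sub>m l 1) G"
    proof -
      have 1: "mat 1 1 (\<lambda>_. v \<bullet> v) + mat 1 l (\<lambda>(i, j). b $ j) * mat l 1 (\<lambda>(i, j). - c $ i)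
          = mat 1 1 (\<lambda>_. w \<bullet> w)"
        using b c by (intro eq_matI) (auto simp: ww scalar_prod_def[of "vec _ _"] scalar_prod_def[of b] sum_negf)
      have 2: "mat l 1 (\<lambda>(i, j). b $ i) + G * mat l 1 (\<lambda>(i, j). - c $ i) = 0\<^sub>m l 1"
      proof (rule eq_matI)
        fix i j assume "i < dim_row (0\<^sub>m l 1 :: real mat)" "j < dim_col (0\<^sub>m l 1 :: real mat)"
        then have ij: "i < l" "j = 0" by auto
        have "b $ i = (\<Sum>q<l. G $$ (i, q) * c $ q)"
          using G c ij by (subst Gc[symmetric]) (auto simp: scalar_prod_def lessThan_atLeast0)
        then show "(mat l 1 (\<lambda>(i, j). b $ i) + G * mat l 1 (\<lambda>(i, j). - c $ i)) $$ (i, j)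
            = 0\<^sub>m l 1 $$ (i, j)"
          using G c ij by (auto simp: scalar_prod_def sum_negf lessThan_atLeast0)
      qed (use G in auto)
      show ?thesis unfolding blocks U_def
        by (subst mult_four_block_mat[of _ 1 1 _ l _ l _ _ 1 _ l]) (use G 1 2 in auto)
    qed
    then have "det (M * U) = (w \<bullet> w) * det G"
      using G by (simp add: det_four_block_mat_lower_left_zero[of _ 1 _ l] det_single)
    then have "det M = (w \<bullet> w) * det G" using det_mult[OF M U] \<open>det U = 1\<close> by simp
    then show thesis
      using that[OF w] minimal by (simp add: dets B_def l_def)
  qed
qed

lemma gram_det_nonneg:
  assumes "set vs \<subseteq> carrier_vec n"
  shows "gram_det n vs \<ge> 0"
  using assms
proof (induction vs)
  case (Cons v vs)
  then have "v \<in> carrier_vec n" "set vs \<subseteq> carrier_vec n" by auto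
  then obtain w where "gram_det n (v # vs) = (w \<bullet> w) * gram_det n vs"
    using gram_det_Cons by blast
  moreover have "w \<bullet> w \<ge> 0" by (auto simp: scalar_prod_def intro: sum_nonneg)
  ultimately show ?case using Cons by simp
qed (simp add: gram_det_Nil)

text \<open>
  The distance from \<open>v\<close> to the span of \<open>vs\<close> is at most the length of \<open>v\<close>. Iterating this gives
  Hadamard's inequality.
\<close>

lemma gram_det_Cons_le:
  assumes v: "v \<in> carrier_vec n" and vs: "set vs \<subseteq> carrier_vec n"
  shows "gram_det n (v # vs) \<le> (v \<bullet> v) * gram_det n vs"
proof -
  obtain w where eq: "gram_det n (v # vs) = (w \<bullet> w) * gram_det n vs"
    and le: "w \<bullet> w \<le> (v - (mat_of_rows n vs)\<^sup>T *\<^sub>v 0\<^sub>v (length vs)) \<bullet>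
                      (v - (mat_of_rows n vs)\<^sup>T *\<^sub>v 0\<^sub>v (length vs))"
    using gram_det_Cons[OF v vs] by (metis zero_carrier_vec)
  have "(mat_of_rows n vs)\<^sup>T *\<^sub>v 0\<^sub>v (length vs) = 0\<^sub>v n"
    by (rule eq_vecI) auto
  then have "w \<bullet> w \<le> v \<bullet> v" using le v by simp
  then show ?thesis using eq gram_det_nonneg[OF vs] by (simp add: mult_right_mono)
qed

text \<open>
  The factor on the right is the Gram determinant of \<open>x\<close> and \<open>y\<close> alone: the squared length of \<open>y\<close>
  times the squared distance from \<open>x\<close> to the line through \<open>y\<close>. The distance from \<open>x\<close> to the
  span of \<open>y # vs\<close>, which contains that line, can only be smaller.
\<close>

lemma gram_det_Cons_Cons_le:
  assumes x: "x \<in> carrier_vec n" and y: "y \<in> carrier_vec n" and vs: "set vs \<subseteq> carrier_vec n"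
  shows "gram_det n (x # y # vs) \<le> ((x \<bullet> x) * (y \<bullet> y) - (x \<bullet> y)\<^sup>2) * gram_det n vs"
proof -
  \<comment> \<open>\<open>t \<cdot>\<^sub>v y\<close> is the projection of \<open>x\<close> onto the line through \<open>y\<close>; for \<open>y = 0\<close> the division
    yields \<open>t = 0\<close>, which is the right value.\<close>
  define t where "t = (x \<bullet> y) / (y \<bullet> y)"
  define e where "e = t \<cdot>\<^sub>v unit_vec (length (y # vs)) 0"
  have e: "e \<in> carrier_vec (length (y # vs))" by (simp add: e_def)
  have yvs: "set (y # vs) \<subseteq> carrier_vec n" using y vs by simp
  have comb: "(mat_of_rows n (y # vs))\<^sup>T *\<^sub>v e = t \<cdot>\<^sub>v y"
    using y by (intro eq_vecI) (auto simp: e_def mat_of_rows_def col_def)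
  have ty: "t \<cdot>\<^sub>v y \<in> carrier_vec n" using y by simp
  obtain w where eq: "gram_det n (x # y # vs) = (w \<bullet> w) * gram_det n (y # vs)"
    and le: "w \<bullet> w \<le> (x - t \<cdot>\<^sub>v y) \<bullet> (x - t \<cdot>\<^sub>v y)"
    using gram_det_Cons[OF x yvs] e comb by metis
  have ww: "0 \<le> w \<bullet> w" and yy: "0 \<le> y \<bullet> y" by (auto simp: scalar_prod_def intro: sum_nonneg)
  have 1: "(x - t \<cdot>\<^sub>v y) \<bullet> (x - t \<cdot>\<^sub>v y) = x \<bullet> x - 2 * t * (x \<bullet> y) + t\<^sup>2 * (y \<bullet> y)"
    using x y ty comm_scalar_prod[OF y x]
    by (simp add: minus_scalar_prod_distrib[of _ n] scalar_prod_minus_distrib[of _ n]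
        power2_eq_square algebra_simps)
  have 2: "(x - t \<cdot>\<^sub>v y) \<bullet> (x - t \<cdot>\<^sub>v y) * (y \<bullet> y) = (x \<bullet> x) * (y \<bullet> y) - (x \<bullet> y)\<^sup>2"
  proof (cases "y \<bullet> y = 0")
    case True
    then have "y = 0\<^sub>v n" using conjugate_square_eq_0_vec[OF y] by simp
    then show ?thesis using x by simp
  next
    case False
    then have "t * (y \<bullet> y) = x \<bullet> y" by (simp add: t_def)
    then have "t\<^sup>2 * (y \<bullet> y) * (y \<bullet> y) = (x \<bullet> y)\<^sup>2"
      by (metis power_mult_distrib power2_eq_square mult.assoc)
    moreover have "2 * t * (x \<bullet> y) * (y \<bullet> y) = 2 * (x \<bullet> y)\<^sup>2"
      using \<open>t * (y \<bullet> y) = x \<bullet> y\<close> by (metis mult.assoc mult.commute power2_eq_square)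
    ultimately show ?thesis unfolding 1 by (simp add: algebra_simps)
  qed
  have "gram_det n (x # y # vs) \<le> (w \<bullet> w) * ((y \<bullet> y) * gram_det n vs)"
    unfolding eq using gram_det_Cons_le[OF y vs] ww by (rule mult_left_mono)
  also have "\<dots> \<le> ((x - t \<cdot>\<^sub>v y) \<bullet> (x - t \<cdot>\<^sub>v y)) * ((y \<bullet> y) * gram_det n vs)"
    using le yy gram_det_nonneg[OF vs] by (intro mult_right_mono) auto
  finally show ?thesis unfolding 2[symmetric] by (simp add: mult.assoc)
qed

section \<open>Pairing overlapping zero-one vectors\<close>

definition zero_one_vecs :: "nat \<Rightarrow> nat \<Rightarrow> real vec set" where
  "zero_one_vecs n k = {v \<in> carrier_vec n. (\<forall>j<n. v $ j \<in> {0, 1}) \<and> (\<Sum>j<n. v $ j) = real k}"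

lemma zero_one_vecs_scalar_prod_self:
  assumes "x \<in> zero_one_vecs n k"
  shows "x \<bullet> x = real k"
proof -
  have "x \<bullet> x = (\<Sum>j<n. x $ j * x $ j)"
    using assms by (auto simp: zero_one_vecs_def scalar_prod_def lessThan_atLeast0)
  also have "\<dots> = (\<Sum>j<n. x $ j)"
    using assms by (intro sum.cong) (auto simp: zero_one_vecs_def)
  finally show ?thesis using assms by (simp add: zero_one_vecs_def)
qed

lemma zero_one_vecs_overlap:
  assumes "x \<in> zero_one_vecs n k" "y \<in> zero_one_vecs n k" "j < n" "x $ j * y $ j \<noteq> 0"
  shows "x \<bullet> y \<ge> 1"
proof -
  have 01: "x $ i \<in> {0, 1}" "y $ i \<in> {0, 1}" if "i < n" for i
    using assms that by (auto simp: zero_one_vecs_def)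
  have "1 \<le> x $ j * y $ j" using 01[OF assms(3)] assms(4) by auto
  also have "\<dots> \<le> (\<Sum>i<n. x $ i * y $ i)"
    by (rule member_le_sum) (use assms 01 in fastforce)+
  also have "\<dots> = x \<bullet> y"
    using assms by (auto simp: zero_one_vecs_def scalar_prod_def lessThan_atLeast0)
  finally show ?thesis .
qed

lemma zero_one_vecs_not_orthogonal:
  assumes "x \<in> zero_one_vecs n k" "y \<in> zero_one_vecs n k" "x \<bullet> y \<noteq> 0"
  shows "x \<bullet> y \<ge> 1"
proof -
  have "x \<bullet> y = (\<Sum>i<n. x $ i * y $ i)"
    using assms by (auto simp: zero_one_vecs_def scalar_prod_def lessThan_atLeast0)
  then have "\<exists>i\<in>{..<n}. x $ i * y $ i \<noteq> 0"
    using assms(3) sum.neutral[of "{..<n}" "\<lambda>i. x $ i * y $ i"] by auto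
  then show ?thesis using zero_one_vecs_overlap[OF assms(1,2)] by auto
qed

text \<open>
  Orthogonal zero-one vectors have disjoint supports, so every column sum of the list is at most 1.
  Counting the ones by rows and by columns compares \<open>length vs * k\<close> with \<open>n\<close>.
\<close>

lemma orthogonal_zero_one_vecs_length:
  assumes vs: "set vs \<subseteq> zero_one_vecs n k"
    and orth: "sorted_wrt (\<lambda>x y. x \<bullet> y = 0) vs"
  shows "length vs * k \<le> n"
proof -
  have col: "(\<Sum>v\<leftarrow>vs. v $ j) \<le> 1" if j: "j < n" for j
    using vs orth
  proof (induction vs)
    case (Cons v vs)
    then have v: "v $ j \<in> {0, 1}" using j by (auto simp: zero_one_vecs_def)
    show ?case
    proof (cases "v $ j = 0")
      case True
      then show ?thesis using Cons by simp
    next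
      case False
      have "u $ j = 0" if "u \<in> set vs" for u
        using zero_one_vecs_overlap[of v n k u j] Cons.prems that j False by fastforce
      then have "(\<Sum>u\<leftarrow>vs. u $ j) = (\<Sum>u\<leftarrow>vs. 0)" by (intro arg_cong[of _ _ sum_list] map_cong) auto
      then show ?thesis using v by auto
    qed
  qed simp
  have "real (length vs * k) = (\<Sum>v\<leftarrow>vs. \<Sum>j<n. v $ j)"
    using vs by (induction vs) (auto simp: zero_one_vecs_def algebra_simps)
  also have "\<dots> = (\<Sum>j<n. \<Sum>v\<leftarrow>vs. v $ j)"
    by (induction vs) (auto simp: sum.distrib)
  also have "\<dots> \<le> (\<Sum>j<n. 1)" using col by (intro sum_mono) auto
  finally have "real (length vs * k) \<le> real n" by simp
  then show ?thesis by linarith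
qed

lemma not_sorted_wrt_pair:
  assumes "\<not> sorted_wrt P vs"
  obtains x y ws where "mset vs = mset (x # y # ws)" "\<not> P x y"
proof -
  have "\<exists>x y ws. mset vs = mset (x # y # ws) \<and> \<not> P x y"
    using assms
  proof (induction vs)
    case (Cons v vs)
    show ?case
    proof (cases "\<forall>y\<in>set vs. P v y")
      case True
      then have "\<not> sorted_wrt P vs" using Cons.prems by simp
      then obtain x y ws where "mset vs = mset (x # y # ws)" "\<not> P x y" using Cons.IH by blast
      then have "mset (v # vs) = mset (x # y # v # ws) \<and> \<not> P x y" by simp
      then show ?thesis by blast
    next
      case False
      then obtain y where y: "y \<in> set vs" "\<not> P v y" by blast
      then have "mset (v # vs) = mset (v # y # remove1 y vs)" by simp
      then show ?thesis using y by blast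
    qed
  qed simp
  then show thesis using that by blast
qed

text \<open>
  The greedy pairing: as long as two of the vectors overlap, they are split off as a block of
  size 2, whose Gram determinant is at most \<open>k\<^sup>2 - 1\<close>. Once all vectors are orthogonal,
  Hadamard's inequality bounds the rest. Here \<open>p\<close> is the number of pairs and \<open>u\<close> the number of
  vectors left over.
\<close>

lemma gram_det_zero_one_vecs_le:
  assumes "set vs \<subseteq> zero_one_vecs n k" and "0 < k"
  shows "\<exists>p u. length vs = 2 * p + u \<and> u * k \<le> n \<and>
           gram_det n vs \<le> ((real k)\<^sup>2 - 1) ^ p * real k ^ u"
  using assms(1)
proof (induction "length vs" arbitrary: vs rule: less_induct)
  case less
  have sub: "zero_one_vecs n k \<subseteq> carrier_vec n" by (auto simp: zero_one_vecs_def)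
  show ?case
  proof (cases "sorted_wrt (\<lambda>x y. x \<bullet> y = 0) vs")
    case True
    have "gram_det n vs \<le> real k ^ length vs"
      using less.prems
    proof (induction vs)
      case (Cons v vs)
      then have "gram_det n (v # vs) \<le> (v \<bullet> v) * gram_det n vs"
        using sub by (intro gram_det_Cons_le) auto
      also have "v \<bullet> v = real k" using Cons.prems by (simp add: zero_one_vecs_scalar_prod_self[of v n k])
      finally show ?case using Cons mult_left_mono[of "gram_det n vs" "real k ^ length vs" "real k"]
        by simp
    qed (simp add: gram_det_Nil)
    then show ?thesis
      using orthogonal_zero_one_vecs_length[OF less.prems True]
      by (intro exI[of _ 0] exI[of _ "length vs"]) simp
  next
    case False
    then obtain x y ws where eq: "mset vs = mset (x # y # ws)" and xy: "x \<bullet> y \<noteq> 0"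
      by (rule not_sorted_wrt_pair)
    have "set vs = insert x (insert y (set ws))" using mset_eq_setD[OF eq] by simp
    then have mem: "x \<in> zero_one_vecs n k" "y \<in> zero_one_vecs n k" "set ws \<subseteq> zero_one_vecs n k"
      using less.prems by auto
    have len: "length vs = length ws + 2" using mset_eq_length[OF eq] by simp
    then obtain p u where pu: "length ws = 2 * p + u" "u * k \<le> n"
      "gram_det n ws \<le> ((real k)\<^sup>2 - 1) ^ p * real k ^ u"
      using less.hyps[of ws] mem(3) by auto
    have ge: "(real k)\<^sup>2 - 1 \<ge> 0" using assms(2) by simp
    have "1 \<le> (x \<bullet> y)\<^sup>2" using zero_one_vecs_not_orthogonal[OF mem(1,2) xy] by simp
    then have pair: "(x \<bullet> x) * (y \<bullet> y) - (x \<bullet> y)\<^sup>2 \<le> (real k)\<^sup>2 - 1"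
      using zero_one_vecs_scalar_prod_self mem by (simp add: power2_eq_square)
    have "gram_det n vs = gram_det n (x # y # ws)"
      using mem sub eq by (intro gram_det_permute) auto
    also have "\<dots> \<le> ((x \<bullet> x) * (y \<bullet> y) - (x \<bullet> y)\<^sup>2) * gram_det n ws"
      using mem sub by (intro gram_det_Cons_Cons_le) auto
    also have "\<dots> \<le> ((real k)\<^sup>2 - 1) * gram_det n ws"
      using pair mem sub by (intro mult_right_mono gram_det_nonneg) auto
    also have "\<dots> \<le> ((real k)\<^sup>2 - 1) * (((real k)\<^sup>2 - 1) ^ p * real k ^ u)"
      using pu ge by (intro mult_left_mono)
    finally show ?thesis using pu len
      by (intro exI[of _ "Suc p"] exI[of _ u]) (simp add: mult.assoc)
  qed
qed

section \<open>The bound on volumes and determinants\<close>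

definition vol_bound :: "nat \<Rightarrow> nat \<Rightarrow> nat \<Rightarrow> real" where
  "vol_bound m n k = rpow (sqrt ((real k)\<^sup>2 - 1)) (real m / 2 - real n / (2 * real k))
     * rpow (real k) (real n / (2 * real k))"

text \<open>
  For \<open>k \<ge> 2\<close>, with \<open>s = sqrt (k\<^sup>2 - 1) > 0\<close>, the bound \<open>s ^ p * sqrt k ^ u\<close> is \<open>s powr (m / 2)\<close> times
  \<open>(k / s) powr (u / 2)\<close>. As \<open>k / s \<ge> 1\<close>, the exponent \<open>u / 2\<close> may be raised to \<open>n / (2 * k)\<close>.
  For \<open>k = 1\<close>, where \<open>s = 0\<close>, the case \<open>m = n\<close> remains: there the exponent of \<open>s\<close> in the bound
  is 0 and the bound equals 1.
\<close>

lemma Vol_le_vol_bound: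
  assumes A: "A \<in> R m n k" and k: "0 < k" and hyp: "k \<ge> 2 \<or> m = n"
  shows "Vol A \<le> vol_bound m n k"
proof -
  have car: "A \<in> carrier_mat m n" using A by (simp add: R_def)
  have "set (rows A) \<subseteq> zero_one_vecs n k"
  proof
    fix v assume "v \<in> set (rows A)"
    then obtain i where "i < m" "v = row A i" using car by (auto simp: rows_def)
    then show "v \<in> zero_one_vecs n k" using A car by (simp add: R_def zero_one_vecs_def)
  qed
  moreover have "mat_of_rows n (rows A) = A" using car mat_of_rows_rows[of A] by auto
  ultimately obtain p u where pu: "m = 2 * p + u" "u * k \<le> n"
    "det (A * A\<^sup>T) \<le> ((real k)\<^sup>2 - 1) ^ p * real k ^ u"
    using gram_det_zero_one_vecs_le[of "rows A" n k] k car by (auto simp: gram_det_def)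
  define s where "s = sqrt ((real k)\<^sup>2 - 1)"
  have "Vol A \<le> sqrt (((real k)\<^sup>2 - 1) ^ p * real k ^ u)"
    unfolding Vol_def using pu(3) by simp
  also have "\<dots> = s ^ p * sqrt (real k) ^ u"
    by (simp add: s_def real_sqrt_mult real_sqrt_power)
  finally have le: "Vol A \<le> s ^ p * sqrt (real k) ^ u" .
  show ?thesis
  proof (cases "k = 1")
    case True
    have "s ^ p \<le> 1" using True by (simp add: s_def power_0_left)
    then show ?thesis using le True hyp by (simp add: vol_bound_def rpow_def)
  next
    case False
    then have k2: "real k \<ge> 2" using k by linarith
    have "(real k)\<^sup>2 > 1" using k2 by (intro one_less_power) auto
    then have s0: "s > 0" by (simp add: s_def)
    have sk: "s \<le> real k" unfolding s_def by (rule real_le_lsqrt) auto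
    have uk: "real u / 2 \<le> real n / (2 * real k)"
    proof -
      have "real u * real k \<le> real n" using pu(2) by (metis of_nat_le_iff of_nat_mult)
      then have "real u \<le> real n / real k" using k by (simp add: pos_le_divide_eq)
      then show ?thesis by (simp add: mult.commute)
    qed
    have "s ^ p * sqrt (real k) ^ u = s powr (real m / 2 - real u / 2) * real k powr (real u / 2)"
    proof -
      have "real m / 2 - real u / 2 = real p" by (simp add: pu(1) field_simps)
      moreover have "sqrt (real k) ^ u = real k powr (real u / 2)"
        using k powr_power[of "real k" "1 / 2" u] by (simp add: powr_half_sqrt)
      ultimately show ?thesis using powr_realpow[OF s0] by simp
    qed
    also have "\<dots> = s powr (real m / 2) * (real k / s) powr (real u / 2)"
      using s0 k by (simp add: powr_diff powr_divide)
    also have "\<dots> \<le> s powr (real m / 2) * (real k / s) powr (real n / (2 * real k))"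
      using sk s0 uk by (intro mult_left_mono powr_mono) auto
    also have "\<dots> = s powr (real m / 2 - real n / (2 * real k)) * real k powr (real n / (2 * real k))"
      using s0 k by (simp add: powr_diff powr_divide)
    also have "\<dots> = vol_bound m n k"
      using s0 k by (auto simp: vol_bound_def rpow_def s_def)
    finally show ?thesis using le by simp
  qed
qed

lemma vol_bound_square:
  assumes "0 < k"
  shows "vol_bound n n k = c k ^ n"
proof -
  have rpow_pow: "rpow x a ^ n = rpow x (real n * a)" if "x \<ge> 0" for x a
    using powr_power[of x a n] that
    by (cases "x = 0") (auto simp: rpow_def power_0_left mult.commute)
  have "c k ^ n = rpow (sqrt ((real k)\<^sup>2 - 1)) (real n * (1 / 2 * (1 - 1 / real k)))
         * rpow (real k) (real n * (1 / (2 * real k)))"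
    unfolding c_def power_mult_distrib using assms by (simp add: rpow_pow)
  also have "real n * (1 / 2 * (1 - 1 / real k)) = real n / 2 - real n / (2 * real k)"
    by (simp add: algebra_simps)
  finally show ?thesis by (simp add: vol_bound_def)
qed

text \<open>
  Replacing \<open>sqrt (k\<^sup>2 - 1)\<close> by the larger number \<open>k\<close> in \<open>c k\<close> makes the two exponents add up to
  \<open>1 / 2\<close>. The inequality is strict because the exponent of that factor is positive.
\<close>

lemma c_less_sqrt:
  assumes "k \<ge> 2"
  shows "c k < sqrt (real k)"
proof -
  define s where "s = sqrt ((real k)\<^sup>2 - 1)"
  define a where "a = 1 / 2 * (1 - 1 / real k)"
  have a: "a > 0" using assms by (simp add: a_def)
  have s0: "s \<ge> 0" using assms by (simp add: s_def)
  have "s < sqrt ((real k)\<^sup>2)" unfolding s_def by (subst real_sqrt_less_iff) simp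
  then have sk: "s < real k" by simp
  have "c k = s powr a * real k powr (1 / (2 * real k))"
    unfolding c_def s_def[symmetric] a_def[symmetric] using a assms by (simp add: rpow_def)
  also have "\<dots> < real k powr a * real k powr (1 / (2 * real k))"
    using powr_less_mono2[OF a s0 sk] assms by (intro mult_strict_right_mono) auto
  also have "\<dots> = real k powr (1 / 2)"
    by (simp add: a_def algebra_simps flip: powr_add)
  finally show ?thesis by (simp add: powr_half_sqrt)
qed

lemma det_le_Vol:
  assumes "A \<in> carrier_mat n n"
  shows "det A \<le> Vol A"
proof -
  have "det (A * A\<^sup>T) = (det A)\<^sup>2"
    using det_mult[OF assms, of "A\<^sup>T"] det_transpose[OF assms] assms by (simp add: power2_eq_square)
  then show ?thesis by (simp add: Vol_def)
qed

theorem theorem3p1: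
  fixes m n k :: nat
  assumes "0 < m" and "m \<le> n" and "0 < k" and "k \<le> n"
  shows "(k \<ge> 2 \<or> m = n \<longrightarrow>
            M_R m n k \<le> rpow (sqrt ((real k)\<^sup>2 - 1)) (real m / 2 - real n / (2 * real k))
                       * rpow (real k) (real n / (2 * real k)))
       \<and> (m = n \<longrightarrow> M_R_square n k \<le> c k ^ n)
       \<and> (k \<ge> 2 \<longrightarrow> c k < sqrt (real k))"
proof (intro conjI impI)
  assume hyp: "k \<ge> 2 \<or> m = n"
  show "M_R m n k \<le> rpow (sqrt ((real k)\<^sup>2 - 1)) (real m / 2 - real n / (2 * real k))
                       * rpow (real k) (real n / (2 * real k))"
    unfolding M_R_def vol_bound_def[symmetric]
    using Vol_le_vol_bound[OF _ \<open>0 < k\<close> hyp] finite_R R_nonempty[OF \<open>k \<le> n\<close>]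
    by (intro Max.boundedI) auto
next
  have "det A \<le> c k ^ n" if "A \<in> R n n k" for A
    using det_le_Vol[of A n] Vol_le_vol_bound[OF that \<open>0 < k\<close>] vol_bound_square[OF \<open>0 < k\<close>, of n] that
    by (auto simp: R_def)
  then show "M_R_square n k \<le> c k ^ n"
    unfolding M_R_square_def using finite_R R_nonempty[OF \<open>k \<le> n\<close>]
    by (intro Max.boundedI) auto
next
  assume "k \<ge> 2"
  then show "c k < sqrt (real k)" by (rule c_less_sqrt)
qed

end
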